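(* Let $\lambda>0$, $\alpha\in(0,1)$ and $\beta\in(0,1)$. For each $n\ge1$ let a random partition of $\{1,\dots,n\}$ be distributed according to the Ewens--Pitman model with parameters $(\alpha,\theta_n)$, where $\theta_n=\lambda n^\beta$. Let $K_n$ be its number of blocks and $M_{r,n}$ its number of blocks of size $r$. Then, as $n\to\infty$, $$\frac{K_n}{n^{\alpha+\beta(1-\alpha)}}\to\frac{\lambda^{1-\alpha}}{\alpha}\quad\text{in probability},$$ and, for every $r\ge1$, $$\frac{M_{r,n}}{K_n}\to q_\alpha(r):=\frac{\alpha\,\Gamma(r-\alpha)}{r!\,\Gamma(1-\alpha)}\quad\text{in probability}.$$
   Context: The Ewens--Pitman model with parameters $\alpha\in(0,1)$ and $\theta>-\alpha$ is the law of the exchangeable random partition of $\{1,\dots,n\}$ for which the probability of any given partition into $k$ blocks with sizes $n_1,\dots,n_k$ (positive integers with $\sum_i n_i=n$) is $$p_{\alpha,\theta}(n_1,\dots,n_k)=\frac{\prod_{i=1}^{k-1}(\theta+i\alpha)}{(\theta+1)_{n-1}}\prod_{j=1}^k(1-\alpha)_{n_j-1},$$ where $(x)_m=\prod_{i=0}^{m-1}(x+i)$ is the rising factorial. In the statement the parameter $\theta=\theta_n$ depends on the sample size $n$, so the laws for different $n$ need not be consistent with each other. *)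

theory Defs
  imports "HOL-Probability.Probability"
begin

text \<open>The probability, under the Ewens--Pitman model, of a given partition \<open>P\<close> of a set of
  \<open>n\<close> elements. The bounds \<open>card P - 1\<close>, \<open>n - 1\<close> and \<open>card B - 1\<close> are truncated
  subtractions on \<^typ>\<open>nat\<close>; nothing is truncated when \<open>n \<ge> 1\<close>, as then \<open>P\<close> is nonempty
  and has nonempty blocks.\<close>

definition ewens_pitman_prob :: "real \<Rightarrow> real \<Rightarrow> nat \<Rightarrow> nat set set \<Rightarrow> real" where
  "ewens_pitman_prob \<alpha> \<theta> n P =
     (\<Prod>i = 1..card P - 1. \<theta> + real i * \<alpha>) / pochhammer (\<theta> + 1) (n - 1)
       * (\<Prod>B\<in>P. pochhammer (1 - \<alpha>) (card B - 1))"

definition ewens_pitman_partition ::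
    "'a measure \<Rightarrow> real \<Rightarrow> real \<Rightarrow> nat \<Rightarrow> ('a \<Rightarrow> nat set set) \<Rightarrow> bool" where
  "ewens_pitman_partition M \<alpha> \<theta> n X \<longleftrightarrow>
     prob_space M \<and>
     X \<in> measurable M (count_space {P. partition_on {1..n} P}) \<and>
     (\<forall>P. partition_on {1..n} P \<longrightarrow>
        measure M {\<omega> \<in> space M. X \<omega> = P} = ewens_pitman_prob \<alpha> \<theta> n P)"

definition num_blocks :: "nat set set \<Rightarrow> nat" where
  "num_blocks P = card P"

definition num_blocks_of_size :: "nat \<Rightarrow> nat set set \<Rightarrow> nat" where
  "num_blocks_of_size r P = card {B \<in> P. card B = r}"

definition sibuya_q :: "real \<Rightarrow> nat \<Rightarrow> real" where
  "sibuya_q \<alpha> r = \<alpha> * Gamma (real r - \<alpha>) / (fact r * Gamma (1 - \<alpha>))"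

text \<open>Convergence in probability to a constant, for random variables that may live on
  different probability spaces.\<close>

definition tendsto_in_prob ::
    "(nat \<Rightarrow> 'a measure) \<Rightarrow> (nat \<Rightarrow> 'a \<Rightarrow> real) \<Rightarrow> real \<Rightarrow> bool" where
  "tendsto_in_prob M Y c \<longleftrightarrow>
     (\<forall>\<epsilon>>0. (\<lambda>n. measure (M n) {\<omega> \<in> space (M n). \<bar>Y n \<omega> - c\<bar> > \<epsilon>}) \<longlonglongrightarrow> 0)"

end

theory Submission
  imports Defs "HOL-Real_Asymp.Real_Asymp"
begin

text \<open>
  Second moment method. Put \<open>w\<^sub>\<theta>(P) = (\<Prod>i<|P|. \<theta> + i\<alpha>) (\<Prod>B\<in>P. (1 - \<alpha>)\<^bsub>|B|-1\<^esub>)\<close>, so that the model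
  has probabilities \<open>w\<^sub>\<theta>(P) / (\<theta>)\<^sub>n\<close>. Deleting a block of size \<open>r\<close> from \<open>P\<close> divides the weight by
  \<open>\<theta> (1 - \<alpha>)\<^bsub>r-1\<^esub>\<close> and replaces \<open>\<theta>\<close> by \<open>\<theta> + \<alpha>\<close>; multiplying by \<open>\<theta> + \<alpha>|P|\<close> does the same shift
  without deleting anything. Hence the factorial moments of \<open>M\<^bsub>r,n\<^esub>\<close> and the moments of
  \<open>\<theta> + \<alpha>K\<^sub>n\<close> are explicit in rising factorials, and everything reduces to
  \<open>(\<theta> + \<alpha>)\<^sub>m / (\<theta>)\<^sub>m \<sim> ((\<theta> + m) / \<theta>)\<^sup>\<alpha>\<close> as \<open>\<theta> \<rightarrow> \<infinity>\<close>, which follows from the log-convexity of \<open>\<Gamma>\<close>.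
  The limits of the first two moments, rescaled by \<open>n\<close> to the power \<open>\<alpha> + \<beta>(1 - \<alpha>)\<close>, match, so
  Chebyshev's inequality applies.
\<close>

section \<open>Exact moments of block counts\<close>

definition partitions :: "'a set \<Rightarrow> 'a set set set" where
  "partitions A = {P. partition_on A P}"

text \<open>The product starts at \<open>i = 0\<close>, unlike the one in
  \<open>ewens_pitman_prob\<close>. The extra factor \<theta> turns the normaliser (\<theta> +
  1)_{n-1} into (\<theta>)_n and lets the deletion of a block act as a clean shift of \<theta>, even
  when the last block goes.\<close>

definition ep_weight :: "real \<Rightarrow> real \<Rightarrow> 'a set set \<Rightarrow> real" where
  "ep_weight \<alpha> \<theta> P =
     (\<Prod>i<card P. \<theta> + real i * \<alpha>) * (\<Prod>B\<in>P. pochhammer (1 - \<alpha>) (card B - 1))"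

section \<open>Set partitions and the deletion of a block\<close>

lemma finite_partitions: "finite A \<Longrightarrow> finite (partitions A)"
  unfolding partitions_def by (rule finitely_many_partition_on)

lemma finite_partition: "finite A \<Longrightarrow> P \<in> partitions A \<Longrightarrow> finite P"
  unfolding partitions_def by (auto intro: finite_elements)

lemma partitions_empty: "partitions {} = {{}}"
  by (simp add: partitions_def partition_on_empty)

lemma partitions_remove_block:
  assumes "P \<in> partitions A" "B \<in> P"
  shows "P - {B} \<in> partitions (A - B)" "B \<subseteq> A" "B \<noteq> {}"
proof -
  have p: "\<Union>P = A" "disjoint P" "{} \<notin> P"
    using assms by (auto simp: partitions_def partition_on_def)
  have "\<Union>(P - {B}) = A - B"
    using p assms(2) unfolding disjoint_def by blast
  then show "P - {B} \<in> partitions (A - B)"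
    using p unfolding partitions_def partition_on_def disjoint_def by auto
  show "B \<subseteq> A" "B \<noteq> {}" using p assms(2) by auto
qed

lemma partitions_insert_block:
  assumes "P \<in> partitions (A - B)" "B \<subseteq> A" "B \<noteq> {}"
  shows "insert B P \<in> partitions A" "B \<notin> P"
proof -
  have p: "\<Union>P = A - B" "disjoint P" "{} \<notin> P"
    using assms by (auto simp: partitions_def partition_on_def)
  show "B \<notin> P" using p assms by auto
  have "disjnt B (\<Union>P)" using p(1) by (auto simp: disjnt_def)
  then show "insert B P \<in> partitions A"
    using assms by (simp add: partitions_def partition_on_insert)
qed

text \<open>Double counting: a partition with a marked block is the same as a nonempty subset
  \<open>B\<close> with a partition of the rest, the inverse of deletion being
  \<open>insert B\<close>. The summand sees only \<open>P - {B}\<close>, which is what deletion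
  leaves.\<close>

lemma sum_partitions_blocks:
  fixes f :: "'a set \<Rightarrow> 'a set set \<Rightarrow> 'b :: comm_monoid_add"
  assumes "finite A"
  shows "(\<Sum>P\<in>partitions A. \<Sum>B\<in>P. f B (P - {B})) =
         (\<Sum>B\<in>Pow A - {{}}. \<Sum>P\<in>partitions (A - B). f B P)"
proof -
  have "(\<Sum>P\<in>partitions A. \<Sum>B\<in>P. f B (P - {B})) =
        (\<Sum>(P, B)\<in>Sigma (partitions A) (\<lambda>P. P). f B (P - {B}))"
    by (rule sum.Sigma) (use assms in \<open>auto intro: finite_partitions finite_partition\<close>)
  also have "\<dots> = (\<Sum>(B, P)\<in>Sigma (Pow A - {{}}) (\<lambda>B. partitions (A - B)). f B P)"
    by (rule sum.reindex_bij_witness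
          [where i = "\<lambda>(B, P). (insert B P, B)" and j = "\<lambda>(P, B). (B, P - {B})"])
       (auto dest: partitions_remove_block partitions_insert_block)
  also have "\<dots> = (\<Sum>B\<in>Pow A - {{}}. \<Sum>P\<in>partitions (A - B). f B P)"
    by (rule sum.Sigma[symmetric]) (use assms in \<open>auto intro: finite_partitions\<close>)
  finally show ?thesis .
qed

text \<open>The \<open>i = 0\<close> factor of the product is \<theta>; the remaining indices drop
  by one, which \<theta> + \<alpha> absorbs.\<close>

lemma ep_weight_remove_block:
  assumes "finite P" "B \<in> P"
  shows "ep_weight \<alpha> \<theta> P =
         \<theta> * pochhammer (1 - \<alpha>) (card B - 1) * ep_weight \<alpha> (\<theta> + \<alpha>) (P - {B})"
proof -
  have c: "card P = Suc (card (P - {B}))"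
    using assms by (rule card.remove)
  have "(\<Prod>i<card P. \<theta> + real i * \<alpha>) = \<theta> * (\<Prod>i<card (P - {B}). \<theta> + \<alpha> + real i * \<alpha>)"
    unfolding c prod.lessThan_Suc_shift by (simp add: distrib_right add.assoc)
  moreover have "(\<Prod>B\<in>P. pochhammer (1 - \<alpha>) (card B - 1)) =
      pochhammer (1 - \<alpha>) (card B - 1) * (\<Prod>B\<in>P - {B}. pochhammer (1 - \<alpha>) (card B - 1))"
    using assms by (rule prod.remove)
  ultimately show ?thesis unfolding ep_weight_def by simp
qed

text \<open>The linear factor appends the next term to the product; splitting off the first term
  instead leaves the product for \<theta> + \<alpha>.\<close>

lemma ep_weight_times_linear:
  "(\<theta> + \<alpha> * real (card P)) * ep_weight \<alpha> \<theta> P = \<theta> * ep_weight \<alpha> (\<theta> + \<alpha>) P"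
proof -
  have "(\<Prod>i<Suc (card P). \<theta> + real i * \<alpha>) = \<theta> * (\<Prod>i<card P. \<theta> + \<alpha> + real i * \<alpha>)"
    unfolding prod.lessThan_Suc_shift by (simp add: distrib_right add.assoc)
  then show ?thesis unfolding ep_weight_def by (simp add: mult_ac)
qed

section \<open>Total weight and weighted block counts\<close>

lemma sum_Pow_card:
  fixes g :: "nat \<Rightarrow> 'b :: comm_semiring_1"
  assumes "finite A"
  shows "(\<Sum>S\<in>Pow A. g (card S)) = (\<Sum>k\<le>card A. of_nat (card A choose k) * g k)"
proof -
  have "(\<Sum>S\<in>Pow A. g (card S)) = (\<Sum>k\<le>card A. \<Sum>S\<in>{S \<in> Pow A. card S = k}. g (card S))"
    by (rule sum.group[symmetric]) (use assms in \<open>auto intro: card_mono\<close>)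
  also have "\<dots> = (\<Sum>k\<le>card A. of_nat (card A choose k) * g k)"
    using n_subsets[OF assms] by (intro sum.cong) auto
  finally show ?thesis .
qed

text \<open>Splitting off the block of a fixed element turns the induction step into the binomial
  theorem for rising factorials.\<close>

lemma sum_ep_weight:
  assumes "finite A"
  shows "(\<Sum>P\<in>partitions A. ep_weight \<alpha> \<theta> P) = pochhammer \<theta> (card A)"
  using assms
\<comment> \<open>\<theta> is generalised because the remaining blocks carry their weight at
  \<theta> + \<alpha>.\<close>
proof (induction "card A" arbitrary: A \<theta> rule: less_induct)
  case less
  show ?case
  proof (cases "A = {}")
    case True
    then show ?thesis by (simp add: partitions_empty ep_weight_def)
  next
    case False
    then obtain x where x: "x \<in> A" by auto
    define A' where "A' = A - {x}"
    have A': "finite A'" "x \<notin> A'" "A = insert x A'" "card A = Suc (card A')"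
    proof -
      show "finite A'" "x \<notin> A'" using less.prems by (auto simp: A'_def)
      show "A = insert x A'" unfolding A'_def using x by (simp only: insert_Diff)
      show "card A = Suc (card A')" unfolding A'_def using less.prems x by (rule card.remove)
    qed
    \<comment> \<open>Exactly one block of \<open>P\<close> contains \<open>x\<close>, so each inner
      sum has a single nonzero term, the weight of \<open>P\<close> itself.\<close>
    have "(\<Sum>P\<in>partitions A. ep_weight \<alpha> \<theta> P) =
        (\<Sum>P\<in>partitions A. \<Sum>B\<in>P. if x \<in> B
           then \<theta> * pochhammer (1 - \<alpha>) (card B - 1) * ep_weight \<alpha> (\<theta> + \<alpha>) (P - {B}) else 0)"
    proof (rule sum.cong[OF refl])
      fix P assume P: "P \<in> partitions A"
      then have fin: "finite P" using less.prems finite_partition by blast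
      obtain B where B: "B \<in> P" "x \<in> B"
        using P x by (auto simp: partitions_def partition_on_def)
      have uniq: "B' = B" if "B' \<in> P" "x \<in> B'" for B'
        using P B that by (auto simp: partitions_def partition_on_def disjoint_def)
      have "(\<Sum>B\<in>P. if x \<in> B
           then \<theta> * pochhammer (1 - \<alpha>) (card B - 1) * ep_weight \<alpha> (\<theta> + \<alpha>) (P - {B}) else 0)
         = (\<Sum>B'\<in>{B}. ep_weight \<alpha> \<theta> P)"
      proof (rule sum.mono_neutral_cong_right[OF fin])
        show "{B} \<subseteq> P" using B by simp
        show "\<forall>B'\<in>P - {B}. (if x \<in> B' then \<theta> * pochhammer (1 - \<alpha>) (card B' - 1)
            * ep_weight \<alpha> (\<theta> + \<alpha>) (P - {B'}) else 0) = 0"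
          using uniq by simp blast
        show "(if x \<in> B' then \<theta> * pochhammer (1 - \<alpha>) (card B' - 1)
            * ep_weight \<alpha> (\<theta> + \<alpha>) (P - {B'}) else 0) = ep_weight \<alpha> \<theta> P"
          if "B' \<in> {B}" for B'
          using that B ep_weight_remove_block[OF fin B(1), of \<alpha> \<theta>] by simp
      qed
      then show "ep_weight \<alpha> \<theta> P = (\<Sum>B\<in>P. if x \<in> B
           then \<theta> * pochhammer (1 - \<alpha>) (card B - 1) * ep_weight \<alpha> (\<theta> + \<alpha>) (P - {B}) else 0)"
        by simp
    qed
    also have "\<dots> = (\<Sum>B\<in>Pow A - {{}}. \<Sum>P\<in>partitions (A - B). if x \<in> B
           then \<theta> * pochhammer (1 - \<alpha>) (card B - 1) * ep_weight \<alpha> (\<theta> + \<alpha>) P else 0)"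
      using sum_partitions_blocks[OF less.prems, of "\<lambda>B P. if x \<in> B
           then \<theta> * pochhammer (1 - \<alpha>) (card B - 1) * ep_weight \<alpha> (\<theta> + \<alpha>) P else 0"] .
    also have "\<dots> = (\<Sum>S\<in>Pow A'. \<theta> * pochhammer (1 - \<alpha>) (card S)
                                * pochhammer (\<theta> + \<alpha>) (card A' - card S))"
    proof -
      \<comment> \<open>Only sets containing \<open>x\<close> contribute. Each is
        \<open>insert x S\<close> for a unique subset \<open>S\<close> of \<open>A'\<close>, and the
        induction hypothesis applies to its complement, which misses \<open>x\<close>.\<close>
      have "(\<Sum>B\<in>Pow A - {{}}. \<Sum>P\<in>partitions (A - B). if x \<in> B
           then \<theta> * pochhammer (1 - \<alpha>) (card B - 1) * ep_weight \<alpha> (\<theta> + \<alpha>) P else 0)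
         = (\<Sum>B\<in>insert x ` Pow A'. \<theta> * pochhammer (1 - \<alpha>) (card B - 1)
                                       * pochhammer (\<theta> + \<alpha>) (card (A - B)))"
      proof (rule sum.mono_neutral_cong_right)
        show "finite (Pow A - {{}})" using less.prems by simp
        show "insert x ` Pow A' \<subseteq> Pow A - {{}}" using A' by auto
        show "\<forall>B\<in>Pow A - {{}} - insert x ` Pow A'. (\<Sum>P\<in>partitions (A - B). if x \<in> B
           then \<theta> * pochhammer (1 - \<alpha>) (card B - 1) * ep_weight \<alpha> (\<theta> + \<alpha>) P else 0) = 0"
        proof
          fix B assume B: "B \<in> Pow A - {{}} - insert x ` Pow A'"
          have "x \<notin> B"
          proof
            assume "x \<in> B"
            then have "B = insert x (B - {x})" by auto
            moreover have "B - {x} \<in> Pow A'" using B by (auto simp: A'_def)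
            ultimately have "B \<in> insert x ` Pow A'" by (rule image_eqI)
            then show False using B by simp
          qed
          then show "(\<Sum>P\<in>partitions (A - B). if x \<in> B
           then \<theta> * pochhammer (1 - \<alpha>) (card B - 1) * ep_weight \<alpha> (\<theta> + \<alpha>) P else 0) = 0"
            by simp
        qed
      next
        fix B assume B: "B \<in> insert x ` Pow A'"
        then have "A - B \<subset> A" using x by auto
        then have "card (A - B) < card A" using less.prems by (rule psubset_card_mono[rotated])
        then have "(\<Sum>P\<in>partitions (A - B). ep_weight \<alpha> (\<theta> + \<alpha>) P)
            = pochhammer (\<theta> + \<alpha>) (card (A - B))"
          using less.prems by (intro less.hyps) auto
        moreover have "x \<in> B" using B by auto
        ultimately show "(\<Sum>P\<in>partitions (A - B). if x \<in> B
             then \<theta> * pochhammer (1 - \<alpha>) (card B - 1) * ep_weight \<alpha> (\<theta> + \<alpha>) P else 0) =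
           \<theta> * pochhammer (1 - \<alpha>) (card B - 1) * pochhammer (\<theta> + \<alpha>) (card (A - B))"
          by (simp add: sum_distrib_left[symmetric])
      qed
      also have "\<dots> = (\<Sum>S\<in>Pow A'. \<theta> * pochhammer (1 - \<alpha>) (card (insert x S) - 1)
                                       * pochhammer (\<theta> + \<alpha>) (card (A - insert x S)))"
        using A'(2) by (subst sum.reindex) (auto simp: inj_on_def)
      also have "\<dots> = (\<Sum>S\<in>Pow A'. \<theta> * pochhammer (1 - \<alpha>) (card S)
                                * pochhammer (\<theta> + \<alpha>) (card A' - card S))"
      proof (rule sum.cong[OF refl])
        fix S assume S: "S \<in> Pow A'"
        then have "finite S" "x \<notin> S" using A' finite_subset by auto
        moreover have "A - insert x S = A' - S" using A' by auto
        ultimately show "\<theta> * pochhammer (1 - \<alpha>) (card (insert x S) - 1)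
              * pochhammer (\<theta> + \<alpha>) (card (A - insert x S)) =
            \<theta> * pochhammer (1 - \<alpha>) (card S) * pochhammer (\<theta> + \<alpha>) (card A' - card S)"
          using S by (simp add: card_Diff_subset)
      qed
      finally show ?thesis .
    qed
    also have "\<dots> = (\<Sum>k\<le>card A'. real (card A' choose k) * (\<theta> * pochhammer (1 - \<alpha>) k
                                * pochhammer (\<theta> + \<alpha>) (card A' - k)))"
      using sum_Pow_card[OF A'(1), of "\<lambda>k. \<theta> * pochhammer (1 - \<alpha>) k
                                * pochhammer (\<theta> + \<alpha>) (card A' - k)"] by simp
    \<comment> \<open>The two parameters add up to \<theta> + 1, and the factor \<theta> in front
      then lengthens the rising factorial by one.\<close>
    also have "\<dots> = \<theta> * pochhammer ((1 - \<alpha>) + (\<theta> + \<alpha>)) (card A')"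
      unfolding pochhammer_binomial_sum by (simp add: sum_distrib_left algebra_simps)
    also have "\<dots> = pochhammer \<theta> (card A)"
      by (simp add: A'(4) pochhammer_rec add.commute)
    finally show ?thesis .
  qed
qed

text \<open>A Palm-type formula: the factor lost with a block of size \<open>r\<close> depends on
  \<open>r\<close> alone and leaves the sum. \<open>h = 1\<close> yields the first moment of the
  block count, and counting the other blocks of size \<open>r\<close> yields the second factorial
  moment. \<open>r \<ge> 1\<close> keeps the empty set from passing as a block.\<close>

lemma sum_partitions_blocks_of_size:
  fixes h :: "'a set set \<Rightarrow> real"
  assumes "finite A" "r \<ge> 1"
  shows "(\<Sum>P\<in>partitions A. (\<Sum>B\<in>{B \<in> P. card B = r}. h (P - {B})) * ep_weight \<alpha> \<theta> P) =
         \<theta> * pochhammer (1 - \<alpha>) (r - 1) *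
         (\<Sum>B\<in>{B. B \<subseteq> A \<and> card B = r}. \<Sum>P\<in>partitions (A - B). h P * ep_weight \<alpha> (\<theta> + \<alpha>) P)"
proof -
  let ?f = "\<lambda>B P. if card B = r then \<theta> * pochhammer (1 - \<alpha>) (r - 1) *
                      (h P * ep_weight \<alpha> (\<theta> + \<alpha>) P) else 0"
  have "(\<Sum>P\<in>partitions A. (\<Sum>B\<in>{B \<in> P. card B = r}. h (P - {B})) * ep_weight \<alpha> \<theta> P) =
      (\<Sum>P\<in>partitions A. \<Sum>B\<in>P. ?f B (P - {B}))"
  proof (rule sum.cong[OF refl])
    fix P assume "P \<in> partitions A"
    then have fin: "finite P" using assms finite_partition by blast
    then have "(\<Sum>B\<in>{B \<in> P. card B = r}. h (P - {B})) * ep_weight \<alpha> \<theta> P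
      = (\<Sum>B\<in>P. if card B = r then h (P - {B}) * ep_weight \<alpha> \<theta> P else 0)"
      by (simp add: sum_distrib_right sum.inter_filter if_distrib[of "\<lambda>z. z * _"] cong: if_cong)
    also have "\<dots> = (\<Sum>B\<in>P. ?f B (P - {B}))"
      by (intro sum.cong) (use ep_weight_remove_block[OF fin, of _ \<alpha> \<theta>] in auto)
    finally show "(\<Sum>B\<in>{B \<in> P. card B = r}. h (P - {B})) * ep_weight \<alpha> \<theta> P
      = (\<Sum>B\<in>P. ?f B (P - {B}))" .
  qed
  also have "\<dots> = (\<Sum>B\<in>Pow A - {{}}. \<Sum>P\<in>partitions (A - B). ?f B P)"
    using sum_partitions_blocks[OF assms(1), of ?f] .
  also have "\<dots> = (\<Sum>B\<in>{B. B \<subseteq> A \<and> card B = r}. \<Sum>P\<in>partitions (A - B).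
       \<theta> * pochhammer (1 - \<alpha>) (r - 1) * (h P * ep_weight \<alpha> (\<theta> + \<alpha>) P))"
    by (rule sum.mono_neutral_cong_right) (use assms in auto)
  finally show ?thesis by (simp add: sum_distrib_left)
qed

text \<open>The case \<open>h = 1\<close>, with the total weight of each complement inserted. If
  \<open>card A < r\<close>, the truncated difference is harmless since the binomial coefficient
  vanishes.\<close>

lemma sum_num_blocks_of_size:
  assumes "finite A" "r \<ge> 1"
  shows "(\<Sum>P\<in>partitions A. real (card {B \<in> P. card B = r}) * ep_weight \<alpha> \<theta> P) =
         real (card A choose r) * pochhammer (1 - \<alpha>) (r - 1) * \<theta>
           * pochhammer (\<theta> + \<alpha>) (card A - r)"
proof -
  have "(\<Sum>B\<in>{B. B \<subseteq> A \<and> card B = r}. \<Sum>P\<in>partitions (A - B). ep_weight \<alpha> (\<theta> + \<alpha>) P)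
     = (\<Sum>B\<in>{B. B \<subseteq> A \<and> card B = r}. pochhammer (\<theta> + \<alpha>) (card A - r))"
    using assms by (intro sum.cong) (auto simp: sum_ep_weight card_Diff_subset finite_subset)
  then show ?thesis
    using sum_partitions_blocks_of_size[OF assms, of "\<lambda>_. 1" \<alpha> \<theta>] n_subsets[OF assms(1)]
    by simp
qed

text \<open>Summing over the blocks of size \<open>r\<close> the number of other such blocks gives
  the falling factorial. The inner sum is the first moment on the complement at \<theta> + \<alpha>,
  hence the second shift. If \<open>card A < 2 * r\<close>, one of the binomial coefficients is
  0.\<close>

lemma sum_num_blocks_of_size_falling:
  assumes "finite A" "r \<ge> 1"
  shows "(\<Sum>P\<in>partitions A. real (card {B \<in> P. card B = r}) *
            (real (card {B \<in> P. card B = r}) - 1) * ep_weight \<alpha> \<theta> P) =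
         real (card A choose r) * real ((card A - r) choose r) * (pochhammer (1 - \<alpha>) (r - 1))\<^sup>2
           * \<theta> * (\<theta> + \<alpha>) * pochhammer (\<theta> + 2 * \<alpha>) (card A - 2 * r)"
proof -
  have "(\<Sum>P\<in>partitions A. real (card {B \<in> P. card B = r}) *
            (real (card {B \<in> P. card B = r}) - 1) * ep_weight \<alpha> \<theta> P)
     = (\<Sum>P\<in>partitions A. (\<Sum>B\<in>{B \<in> P. card B = r}. real (card {B' \<in> P - {B}. card B' = r}))
          * ep_weight \<alpha> \<theta> P)"
  proof (rule sum.cong[OF refl])
    fix P assume "P \<in> partitions A"
    then have fin: "finite P" using assms finite_partition by blast
    have "real (card {B' \<in> P - {B}. card B' = r}) = real (card {B \<in> P. card B = r}) - 1"
      if "B \<in> {B \<in> P. card B = r}" for B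
    proof -
      have "{B' \<in> P - {B}. card B' = r} = {B \<in> P. card B = r} - {B}" by auto
      moreover have "card {B \<in> P. card B = r} = Suc (card ({B \<in> P. card B = r} - {B}))"
        using fin that by (intro card.remove) auto
      ultimately show ?thesis by simp
    qed
    then have "(\<Sum>B\<in>{B \<in> P. card B = r}. real (card {B' \<in> P - {B}. card B' = r})) =
       real (card {B \<in> P. card B = r}) * (real (card {B \<in> P. card B = r}) - 1)"
      by simp
    then show "real (card {B \<in> P. card B = r}) *
            (real (card {B \<in> P. card B = r}) - 1) * ep_weight \<alpha> \<theta> P =
       (\<Sum>B\<in>{B \<in> P. card B = r}. real (card {B' \<in> P - {B}. card B' = r})) * ep_weight \<alpha> \<theta> P"
      by simp
  qed
  moreover have "(\<Sum>B\<in>{B. B \<subseteq> A \<and> card B = r}. \<Sum>P\<in>partitions (A - B).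
          real (card {B \<in> P. card B = r}) * ep_weight \<alpha> (\<theta> + \<alpha>) P)
     = (\<Sum>B\<in>{B. B \<subseteq> A \<and> card B = r}. real ((card A - r) choose r) * pochhammer (1 - \<alpha>) (r - 1)
          * (\<theta> + \<alpha>) * pochhammer (\<theta> + 2 * \<alpha>) (card A - 2 * r))"
  proof (rule sum.cong[OF refl])
    fix B assume "B \<in> {B. B \<subseteq> A \<and> card B = r}"
    then have "finite (A - B)" "card (A - B) = card A - r"
      using assms by (auto simp: card_Diff_subset finite_subset)
    moreover have "card A - r - r = card A - 2 * r" by simp
    ultimately show "(\<Sum>P\<in>partitions (A - B).
          real (card {B \<in> P. card B = r}) * ep_weight \<alpha> (\<theta> + \<alpha>) P) =
        real ((card A - r) choose r) * pochhammer (1 - \<alpha>) (r - 1)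
          * (\<theta> + \<alpha>) * pochhammer (\<theta> + 2 * \<alpha>) (card A - 2 * r)"
      using sum_num_blocks_of_size[OF _ assms(2), of "A - B" \<alpha> "\<theta> + \<alpha>"]
      by (simp add: algebra_simps)
  qed
  ultimately show ?thesis
    using sum_partitions_blocks_of_size
        [OF assms, of "\<lambda>P. real (card {B \<in> P. card B = r})" \<alpha> \<theta>] n_subsets[OF assms(1), of r]
    by (simp add: power2_eq_square)
qed

lemma sum_num_blocks:
  assumes "finite A"
  shows "(\<Sum>P\<in>partitions A. (\<theta> + \<alpha> * real (card P)) * ep_weight \<alpha> \<theta> P) =
         \<theta> * pochhammer (\<theta> + \<alpha>) (card A)"
  unfolding ep_weight_times_linear sum_distrib_left[symmetric] sum_ep_weight[OF assms] ..

text \<open>The shift is applied twice: the second linear factor has constant term \<theta> +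
  \<alpha> to fit the weight produced by the first.\<close>

lemma sum_num_blocks_rising:
  assumes "finite A"
  shows "(\<Sum>P\<in>partitions A. (\<theta> + \<alpha> * real (card P)) * (\<theta> + \<alpha> + \<alpha> * real (card P))
            * ep_weight \<alpha> \<theta> P) =
         \<theta> * (\<theta> + \<alpha>) * pochhammer (\<theta> + 2 * \<alpha>) (card A)"
proof -
  have "(\<theta> + \<alpha> * real (card P)) * (\<theta> + \<alpha> + \<alpha> * real (card P)) * ep_weight \<alpha> \<theta> P
     = \<theta> * ((\<theta> + \<alpha> + \<alpha> * real (card P)) * ep_weight \<alpha> (\<theta> + \<alpha>) P)" for P :: "'a set set"
    using arg_cong[OF ep_weight_times_linear[of \<theta> \<alpha> P],
        of "\<lambda>z. (\<theta> + \<alpha> + \<alpha> * real (card P)) * z"]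
    by (simp only: mult_ac)
  then have "(\<Sum>P\<in>partitions A. (\<theta> + \<alpha> * real (card P)) * (\<theta> + \<alpha> + \<alpha> * real (card P))
            * ep_weight \<alpha> \<theta> P) =
      \<theta> * (\<Sum>P\<in>partitions A. (\<theta> + \<alpha> + \<alpha> * real (card P)) * ep_weight \<alpha> (\<theta> + \<alpha>) P)"
    by (simp only: sum_distrib_left)
  also have "\<dots> = \<theta> * (\<theta> + \<alpha>) * pochhammer (\<theta> + 2 * \<alpha>) (card A)"
    unfolding sum_num_blocks[OF assms, of "\<theta> + \<alpha>" \<alpha>] by (simp add: add.assoc)
  finally show ?thesis .
qed

section \<open>Ratios of rising factorials\<close>

text \<open>x + a is the convex combination of x and x + 1 with weight a on x + 1; log-convexity
  bounds Gamma there, and the recurrence at x + 1 turns the bound into a power of x.\<close>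

lemma Gamma_ratio_upper:
  fixes x a :: real
  assumes "x > 0" "0 < a" "a < 1"
  shows "Gamma (x + a) \<le> x powr a * Gamma x"
proof -
  have "ln (Gamma ((1 - a) *\<^sub>R x + a *\<^sub>R (x + 1))) \<le> (1 - a) * ln (Gamma x) + a * ln (Gamma (x + 1))"
    using convex_onD[OF log_convex_Gamma_real, of a x "x + 1"] assms by simp
  also have "(1 - a) *\<^sub>R x + a *\<^sub>R (x + 1) = x + a"
    by (simp add: algebra_simps)
  also have "Gamma (x + 1) = x * Gamma x"
    using assms by (simp add: Gamma_plus1 nonpos_Ints_def)
  also have "(1 - a) * ln (Gamma x) + a * ln (x * Gamma x) = ln (x powr a * Gamma x)"
    using assms by (simp add: ln_mult ln_powr algebra_simps)
  finally show ?thesis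
    using assms by (subst (asm) ln_le_cancel_iff) auto
qed

lemma Gamma_ratio_tendsto:
  fixes a :: real
  assumes "0 < a" "a < 1"
  shows "((\<lambda>x. Gamma (x + a) / Gamma x / x powr a) \<longlongrightarrow> 1) at_top"
proof (rule tendsto_sandwich[OF _ _ _ tendsto_const])
  show "((\<lambda>x. (x / (x + a)) powr (1 - a)) \<longlongrightarrow> 1) at_top"
    by real_asymp
  show "\<forall>\<^sub>F x in at_top. Gamma (x + a) / Gamma x / x powr a \<le> 1"
    using eventually_gt_at_top[of 0]
  proof eventually_elim
    case (elim x)
    then show ?case using Gamma_ratio_upper[of x a] assms by (simp add: field_simps)
  qed
  show "\<forall>\<^sub>F x in at_top. (x / (x + a)) powr (1 - a) \<le> Gamma (x + a) / Gamma x / x powr a"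
    using eventually_gt_at_top[of 0]
  proof eventually_elim
    case (elim x)
    \<comment> \<open>The same bound for the step from x + a to x + 1, with exponent 1 - a, supplies
      the matching lower estimate.\<close>
    have "x * Gamma x \<le> (x + a) powr (1 - a) * Gamma (x + a)"
      using Gamma_ratio_upper[of "x + a" "1 - a"] assms elim
      by (simp add: Gamma_plus1 nonpos_Ints_def)
    moreover have "x = x powr (1 - a) * x powr a"
      using elim by (simp add: powr_add[symmetric])
    ultimately have "x powr (1 - a) * x powr a * Gamma x \<le> (x + a) powr (1 - a) * Gamma (x + a)"
      by simp
    then show ?case using elim assms by (simp add: powr_divide field_simps)
  qed
qed

text \<open>The ratio is \<open>Gamma (x + m + a) / Gamma (x + m)\<close> divided by
  \<open>Gamma (x + a) / Gamma x\<close>, hence asymptotic to ((x + m) / x)^a. As b < 1, x ~ l n^b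
  is negligible against m ~ n, which leaves (n / (l n^b))^a.\<close>

lemma pochhammer_ratio_tendsto:
  fixes x :: "nat \<Rightarrow> real" and m :: "nat \<Rightarrow> nat" and a b l :: real
  assumes "0 < a" "a < 1" "0 < b" "b < 1" "l > 0"
    and x: "(\<lambda>n. x n / real n powr b) \<longlonglongrightarrow> l"
    and m: "(\<lambda>n. real (m n) / real n) \<longlonglongrightarrow> 1"
  shows "(\<lambda>n. pochhammer (x n + a) (m n) / pochhammer (x n) (m n) / real n powr (a * (1 - b)))
           \<longlonglongrightarrow> l powr (- a)"
proof -
  \<comment> \<open>The correction factor of the power approximation, used at \<open>x n\<close> and
    at \<open>x n + real (m n)\<close>, both of which tend to infinity.\<close>
  define g where "g x = Gamma (x + a) / Gamma x / x powr a" for x :: real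
  have g: "(g \<longlongrightarrow> 1) at_top"
    unfolding g_def using Gamma_ratio_tendsto assms by blast
  have nb: "filterlim (\<lambda>n. real n powr b) at_top sequentially"
    using assms by real_asymp
  have ev: "\<forall>\<^sub>F n in sequentially. x n / real n powr b > l / 2"
    using order_tendstoD(1)[OF x, of "l / 2"] assms by simp
  have xtop: "filterlim x at_top sequentially"
  proof -
    have "filterlim (\<lambda>n. x n / real n powr b * real n powr b) at_top sequentially"
      using x nb assms by (intro filterlim_tendsto_pos_mult_at_top)
    moreover have "\<forall>\<^sub>F n in sequentially. x n / real n powr b * real n powr b = x n"
      using eventually_gt_at_top[of "0::nat"] by eventually_elim simp
    ultimately show ?thesis by (simp add: filterlim_cong)
  qed
  have xmtop: "filterlim (\<lambda>n. x n + real (m n)) at_top sequentially"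
    by (rule filterlim_at_top_mono[OF xtop]) auto
  have xn: "(\<lambda>n. x n / real n) \<longlonglongrightarrow> 0"
  proof -
    have "(\<lambda>n. real n powr (b - 1)) \<longlonglongrightarrow> 0" using assms by real_asymp
    from tendsto_mult[OF x this] have "(\<lambda>n. x n / real n powr b * real n powr (b - 1)) \<longlonglongrightarrow> 0"
      by simp
    then show ?thesis
      by (rule Lim_transform_eventually)
         (use eventually_gt_at_top[of "0::nat"] in \<open>auto elim!: eventually_mono simp: powr_diff\<close>)
  qed
  have "(\<lambda>n. (x n + real (m n)) / real n) \<longlonglongrightarrow> 1"
    using tendsto_add[OF xn m] by (simp add: add_divide_distrib)
  from tendsto_powr[OF this tendsto_const, of a]
  have 1: "(\<lambda>n. ((x n + real (m n)) / real n) powr a) \<longlonglongrightarrow> 1"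
    by simp
  have 2: "(\<lambda>n. (x n / real n powr b) powr (- a)) \<longlonglongrightarrow> l powr (- a)"
    using assms by (intro tendsto_powr[OF x tendsto_const]) auto
  have 3: "(\<lambda>n. g (x n + real (m n)) / g (x n)) \<longlonglongrightarrow> 1 / 1"
    by (intro tendsto_divide filterlim_compose[OF g] xtop xmtop) auto
  have "(\<lambda>n. g (x n + real (m n)) / g (x n) * (((x n + real (m n)) / real n) powr a
           * (x n / real n powr b) powr (- a))) \<longlonglongrightarrow> 1 / 1 * (1 * l powr (- a))"
    by (intro tendsto_mult 1 2 3)
  moreover have "\<forall>\<^sub>F n in sequentially. g (x n + real (m n)) / g (x n) *
        (((x n + real (m n)) / real n) powr a * (x n / real n powr b) powr (- a)) =
      pochhammer (x n + a) (m n) / pochhammer (x n) (m n) / real n powr (a * (1 - b))"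
    using eventually_gt_at_top[of 0] filterlim_at_top_dense[THEN iffD1, OF xtop, rule_format, of 0]
  proof eventually_elim
    case (elim n)
    define y where "y = x n + real (m n)"
    have y: "y > 0" using elim by (simp add: y_def)
    have p: "pochhammer (x n) (m n) = Gamma y / Gamma (x n)"
      "pochhammer (x n + a) (m n) = Gamma (y + a) / Gamma (x n + a)"
      unfolding y_def using elim assms
      by (subst pochhammer_Gamma; force simp: nonpos_Ints_def add_ac)+
    have pos: "Gamma y > 0" "Gamma (x n) > 0" "Gamma (y + a) > 0" "Gamma (x n + a) > 0"
      using elim y assms by auto
    have 1: "(x n / real n powr b) powr (- a) = real n powr (a * b) / x n powr a"
      using elim by (simp add: powr_divide powr_powr powr_minus field_simps)
    have 2: "(y / real n) powr a = y powr a / real n powr a"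
      using elim y by (simp add: powr_divide)
    have 3: "real n powr (a * (1 - b)) = real n powr a / real n powr (a * b)"
      using elim by (simp add: powr_diff[symmetric] algebra_simps)
    have "x n powr a > 0" "y powr a > 0" "real n powr a > 0" "real n powr (a * b) > 0"
      using elim y by auto
    then show ?case
      unfolding g_def y_def[symmetric] p 1 2 3 using pos by (simp add: field_simps)
  qed
  ultimately show ?thesis by (simp add: tendsto_cong)
qed

lemma pochhammer_over_power_tendsto:
  fixes y :: "nat \<Rightarrow> real"
  assumes "(\<lambda>n. y n / real n) \<longlonglongrightarrow> 1"
  shows "(\<lambda>n. pochhammer (y n) r / real n ^ r) \<longlonglongrightarrow> 1"
proof -
  have "(\<lambda>n. \<Prod>i<r. (y n + real i) / real n) \<longlonglongrightarrow> (\<Prod>i<r. 1)"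
  proof (rule tendsto_prod)
    fix i
    have "(\<lambda>n. real i / real n) \<longlonglongrightarrow> 0" by real_asymp
    from tendsto_add[OF assms this] show "(\<lambda>n. (y n + real i) / real n) \<longlonglongrightarrow> 1"
      by (simp add: add_divide_distrib)
  qed
  then show ?thesis by (simp add: pochhammer_prod prod_dividef lessThan_atLeast0)
qed

lemma choose_over_power_tendsto:
  "(\<lambda>n. real ((n - k) choose r) / real n ^ r) \<longlonglongrightarrow> 1 / fact r"
proof -
  \<comment> \<open>A binomial coefficient is, up to r!, the rising factorial of length r that
    starts at n - k - r + 1.\<close>
  have "(\<lambda>n. (real n - real k - real r + 1) / real n) \<longlonglongrightarrow> 1" by real_asymp
  from pochhammer_over_power_tendsto[OF this, of r]
  have "(\<lambda>n. pochhammer (real n - real k - real r + 1) r / real n ^ r / fact r) \<longlonglongrightarrow> 1 / fact r"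
    by (intro tendsto_divide) auto
  moreover have "\<forall>\<^sub>F n in sequentially. pochhammer (real n - real k - real r + 1) r / real n ^ r / fact r
      = real ((n - k) choose r) / real n ^ r"
    using eventually_ge_at_top[of k]
    by eventually_elim (simp add: binomial_gbinomial gbinomial_pochhammer' of_nat_diff)
  ultimately show ?thesis by (simp add: tendsto_cong)
qed

section \<open>Convergence in probability\<close>

text \<open>A finite sum against the explicit probabilities instead of an integral: moments are
  computed without a sample space, and \<open>measure_ewens_pitman_partition\<close> provides the
  link to one.\<close>

definition ep_mean :: "real \<Rightarrow> real \<Rightarrow> nat \<Rightarrow> (nat set set \<Rightarrow> real) \<Rightarrow> real" where
  "ep_mean \<alpha> \<theta> n f = (\<Sum>P\<in>partitions {1..n}. f P * ewens_pitman_prob \<alpha> \<theta> n P)"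

lemma ep_mean_add: "ep_mean \<alpha> \<theta> n (\<lambda>P. f P + g P) = ep_mean \<alpha> \<theta> n f + ep_mean \<alpha> \<theta> n g"
  by (simp add: ep_mean_def distrib_right sum.distrib)

lemma ep_mean_diff: "ep_mean \<alpha> \<theta> n (\<lambda>P. f P - g P) = ep_mean \<alpha> \<theta> n f - ep_mean \<alpha> \<theta> n g"
  by (simp add: ep_mean_def left_diff_distrib sum_subtractf)

lemma ep_mean_cmult: "ep_mean \<alpha> \<theta> n (\<lambda>P. c * f P) = c * ep_mean \<alpha> \<theta> n f"
  by (simp add: ep_mean_def sum_distrib_left mult.assoc)

lemma ep_mean_divide: "ep_mean \<alpha> \<theta> n (\<lambda>P. f P / c) = ep_mean \<alpha> \<theta> n f / c"
  by (simp add: ep_mean_def sum_divide_distrib)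

text \<open>As n \<ge> 1, the partition is nonempty and \<open>card P - 1\<close> is a true
  subtraction. Weight and normaliser both carry the extra factor \<theta>, which cancels.\<close>

lemma ewens_pitman_prob_eq_weight:
  assumes "\<theta> > 0" "n \<ge> 1" "P \<in> partitions {1..n}"
  shows "ewens_pitman_prob \<alpha> \<theta> n P = ep_weight \<alpha> \<theta> P / pochhammer \<theta> n"
proof -
  obtain m where m: "n = Suc m" using assms(2) by (cases n) auto
  have "finite P" using assms finite_partition by blast
  moreover have "P \<noteq> {}" using assms by (auto simp: partitions_def partition_on_def)
  ultimately obtain k where k: "card P = Suc k"
    by (metis card_gt_0_iff gr0_implies_Suc)
  have "(\<Prod>i<Suc k. \<theta> + real i * \<alpha>) = \<theta> * (\<Prod>i = 1..k. \<theta> + real i * \<alpha>)"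
    unfolding prod.lessThan_Suc_shift
    by (simp add: prod.atLeast1_atMost_eq)
  then show ?thesis
    using assms(1) by (simp add: ewens_pitman_prob_def ep_weight_def k m pochhammer_rec)
qed

lemma ep_mean_eq_weight:
  assumes "\<theta> > 0" "n \<ge> 1"
  shows "ep_mean \<alpha> \<theta> n f = (\<Sum>P\<in>partitions {1..n}. f P * ep_weight \<alpha> \<theta> P) / pochhammer \<theta> n"
  using assms by (simp add: ep_mean_def ewens_pitman_prob_eq_weight sum_divide_distrib)

text \<open>This is the normalisation of the model, obtained from the total weight.\<close>

lemma ep_mean_const:
  assumes "\<theta> > 0" "n \<ge> 1"
  shows "ep_mean \<alpha> \<theta> n (\<lambda>_. c) = c"
proof -
  have "pochhammer \<theta> n > 0" using assms pochhammer_pos by blast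
  then show ?thesis
    using assms by (simp add: ep_mean_eq_weight sum_distrib_left[symmetric] sum_ep_weight)
qed

section \<open>First and second moments under the model\<close>

lemma ep_mean_num_blocks:
  assumes "\<theta> > 0" "n \<ge> 1" "\<alpha> > 0"
  shows "ep_mean \<alpha> \<theta> n (\<lambda>P. real (num_blocks P)) =
         (\<theta> * (pochhammer (\<theta> + \<alpha>) n / pochhammer \<theta> n) - \<theta>) / \<alpha>"
proof -
  have "ep_mean \<alpha> \<theta> n (\<lambda>P. \<theta> + \<alpha> * real (num_blocks P)) =
      \<theta> * pochhammer (\<theta> + \<alpha>) n / pochhammer \<theta> n"
    using assms sum_num_blocks[of "{1..n}" \<theta> \<alpha>] by (simp add: ep_mean_eq_weight num_blocks_def)
  then show ?thesis
    using assms by (simp add: ep_mean_add ep_mean_const ep_mean_cmult field_simps)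
qed

text \<open>The shift by 2\<alpha> is kept as a product \<open>R * R'\<close> of two shifts by
  \<alpha>: \<open>pochhammer_ratio_tendsto\<close> treats shifts below 1, and 2\<alpha> may exceed
  1.\<close>

lemma ep_mean_num_blocks_sq:
  assumes "\<theta> > 0" "n \<ge> 1" "\<alpha> > 0"
  defines "R \<equiv> pochhammer (\<theta> + \<alpha>) n / pochhammer \<theta> n"
  defines "R' \<equiv> pochhammer (\<theta> + \<alpha> + \<alpha>) n / pochhammer (\<theta> + \<alpha>) n"
  shows "ep_mean \<alpha> \<theta> n (\<lambda>P. (real (num_blocks P))\<^sup>2) =
         (\<theta> * (\<theta> + \<alpha>) * R * R' - \<alpha> * \<theta> * R - 2 * \<theta>\<^sup>2 * R + \<theta>\<^sup>2) / \<alpha>\<^sup>2"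
proof -
  have "pochhammer (\<theta> + \<alpha>) n > 0" using assms by (intro pochhammer_pos) auto
  then have "ep_mean \<alpha> \<theta> n (\<lambda>P. (\<theta> + \<alpha> * real (num_blocks P)) * (\<theta> + \<alpha> + \<alpha> * real (num_blocks P)))
      = \<theta> * (\<theta> + \<alpha>) * R * R'"
    using assms(1-3) sum_num_blocks_rising[of "{1..n}" \<theta> \<alpha>]
    by (simp add: ep_mean_eq_weight num_blocks_def R_def R'_def add.assoc)
  \<comment> \<open>Expanding in powers of the number of blocks isolates the square, since the mean
    is already known.\<close>
  also have "(\<lambda>P. (\<theta> + \<alpha> * real (num_blocks P)) * (\<theta> + \<alpha> + \<alpha> * real (num_blocks P))) =
     (\<lambda>P. \<theta> * (\<theta> + \<alpha>) + (\<alpha> * (2 * \<theta> + \<alpha>) * real (num_blocks P)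
             + \<alpha>\<^sup>2 * (real (num_blocks P))\<^sup>2))"
    by (intro ext) (simp add: algebra_simps power2_eq_square)
  finally have "\<theta> * (\<theta> + \<alpha>) + (\<alpha> * (2 * \<theta> + \<alpha>) * ((\<theta> * R - \<theta>) / \<alpha>)
      + \<alpha>\<^sup>2 * ep_mean \<alpha> \<theta> n (\<lambda>P. (real (num_blocks P))\<^sup>2)) = \<theta> * (\<theta> + \<alpha>) * R * R'"
    unfolding ep_mean_add ep_mean_cmult ep_mean_const[OF assms(1,2)]
      ep_mean_num_blocks[OF assms(1-3)] R_def .
  then have "\<alpha>\<^sup>2 * ep_mean \<alpha> \<theta> n (\<lambda>P. (real (num_blocks P))\<^sup>2) =
      \<theta> * (\<theta> + \<alpha>) * R * R' - \<theta> * (\<theta> + \<alpha>) - (2 * \<theta> + \<alpha>) * (\<theta> * R - \<theta>)"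
    using assms(3) by simp
  also have "\<dots> = \<theta> * (\<theta> + \<alpha>) * R * R' - \<alpha> * \<theta> * R - 2 * \<theta>\<^sup>2 * R + \<theta>\<^sup>2"
    by (simp add: algebra_simps power2_eq_square)
  finally show ?thesis using assms(3) by (simp add: field_simps)
qed

text \<open>The normaliser splits as (\<theta>)_n = (\<theta>)_{n-r} (\<theta> + n - r)_r. The first
  part forms a ratio of rising factorials of equal length, the second has the fixed length
  r.\<close>

lemma ep_mean_num_blocks_of_size:
  assumes "\<theta> > 0" "n \<ge> 1" "r \<ge> 1" "r \<le> n"
  shows "ep_mean \<alpha> \<theta> n (\<lambda>P. real (num_blocks_of_size r P)) =
         real (n choose r) * pochhammer (1 - \<alpha>) (r - 1) * \<theta>
           * (pochhammer (\<theta> + \<alpha>) (n - r) / pochhammer \<theta> (n - r))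
           / pochhammer (\<theta> + real (n - r)) r"
  using assms sum_num_blocks_of_size[of "{1..n}" r \<alpha> \<theta>]
    pochhammer_product'[of \<theta> "n - r" r]
  by (simp add: ep_mean_eq_weight num_blocks_of_size_def)

text \<open>The normaliser is split at n - 2r, and the double shift is again written as two shifts
  by \<alpha>.\<close>

lemma ep_mean_num_blocks_of_size_falling:
  assumes "\<theta> > 0" "n \<ge> 1" "r \<ge> 1" "2 * r \<le> n" "\<alpha> > 0"
  shows "ep_mean \<alpha> \<theta> n (\<lambda>P. real (num_blocks_of_size r P) * (real (num_blocks_of_size r P) - 1)) =
         real (n choose r) * real ((n - r) choose r) * (pochhammer (1 - \<alpha>) (r - 1))\<^sup>2
           * \<theta> * (\<theta> + \<alpha>)
           * (pochhammer (\<theta> + \<alpha>) (n - 2 * r) / pochhammer \<theta> (n - 2 * r))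
           * (pochhammer (\<theta> + \<alpha> + \<alpha>) (n - 2 * r) / pochhammer (\<theta> + \<alpha>) (n - 2 * r))
           / pochhammer (\<theta> + real (n - 2 * r)) (2 * r)"
proof -
  have "pochhammer (\<theta> + \<alpha>) (n - 2 * r) > 0" using assms by (intro pochhammer_pos) auto
  then show ?thesis
    using assms sum_num_blocks_of_size_falling[of "{1..n}" r \<alpha> \<theta>]
      pochhammer_product'[of \<theta> "n - 2 * r" "2 * r"]
    by (simp add: ep_mean_eq_weight num_blocks_of_size_def add.assoc)
qed

section \<open>From moments to convergence in probability\<close>

lemma measure_ewens_pitman_partition:
  assumes "ewens_pitman_partition M \<alpha> \<theta> n X"
  shows "measure M {\<omega> \<in> space M. Q (X \<omega>)} =
         ep_mean \<alpha> \<theta> n (\<lambda>P. if Q P then 1 else 0)"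
proof -
  interpret prob_space M using assms by (simp add: ewens_pitman_partition_def)
  have X: "X \<in> measurable M (count_space (partitions {1..n}))"
    using assms by (simp add: ewens_pitman_partition_def partitions_def)
  have fin: "finite {P \<in> partitions {1..n}. Q P}"
    by (simp add: finite_partitions)
  \<comment> \<open>A finite disjoint union of point events, whose probabilities the model
    prescribes.\<close>
  have "{\<omega> \<in> space M. Q (X \<omega>)} = (\<Union>P\<in>{P \<in> partitions {1..n}. Q P}. {\<omega> \<in> space M. X \<omega> = P})"
    using measurable_space[OF X] by auto
  also have "measure M \<dots> = (\<Sum>P\<in>{P \<in> partitions {1..n}. Q P}. measure M {\<omega> \<in> space M. X \<omega> = P})"
  proof (rule finite_measure_finite_Union[OF fin])
    show "(\<lambda>P. {\<omega> \<in> space M. X \<omega> = P}) ` {P \<in> partitions {1..n}. Q P} \<subseteq> events"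
    proof clarify
      fix P assume "P \<in> partitions {1..n}"
      then have "X -` {P} \<inter> space M \<in> events" by (intro measurable_sets[OF X]) auto
      also have "X -` {P} \<inter> space M = {\<omega> \<in> space M. X \<omega> = P}" by auto
      finally show "{\<omega> \<in> space M. X \<omega> = P} \<in> events" .
    qed
  qed (auto simp: disjoint_family_on_def)
  also have "\<dots> = (\<Sum>P\<in>{P \<in> partitions {1..n}. Q P}. ewens_pitman_prob \<alpha> \<theta> n P)"
    using assms by (intro sum.cong) (auto simp: ewens_pitman_partition_def partitions_def)
  also have "\<dots> = ep_mean \<alpha> \<theta> n (\<lambda>P. if Q P then 1 else 0)"
    unfolding ep_mean_def by (intro sum.mono_neutral_cong_left) (auto simp: finite_partitions)
  finally show ?thesis .
qed

text \<open>Markov's inequality for the squared distance to \<open>c\<close>, the intended limit;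
  centring there rather than at the mean leaves only raw moments to control.\<close>

lemma ewens_pitman_Chebyshev:
  assumes "ewens_pitman_partition M \<alpha> \<theta> n X" "\<theta> > 0" "n \<ge> 1" "\<epsilon> > 0"
  shows "measure M {\<omega> \<in> space M. \<bar>f (X \<omega>) - c\<bar> > \<epsilon>} \<le>
         (ep_mean \<alpha> \<theta> n (\<lambda>P. (f P)\<^sup>2) - 2 * c * ep_mean \<alpha> \<theta> n f + c\<^sup>2) / \<epsilon>\<^sup>2"
proof -
  \<comment> \<open>Nonnegativity is read off from the measure, not from the product
    formula.\<close>
  have nonneg: "ewens_pitman_prob \<alpha> \<theta> n P \<ge> 0" if "P \<in> partitions {1..n}" for P
  proof -
    have "ewens_pitman_prob \<alpha> \<theta> n P = measure M {\<omega> \<in> space M. X \<omega> = P}"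
      using assms(1) that by (simp add: ewens_pitman_partition_def partitions_def)
    then show ?thesis by simp
  qed
  have "measure M {\<omega> \<in> space M. \<bar>f (X \<omega>) - c\<bar> > \<epsilon>} =
      ep_mean \<alpha> \<theta> n (\<lambda>P. if \<bar>f P - c\<bar> > \<epsilon> then 1 else 0)"
    by (rule measure_ewens_pitman_partition[OF assms(1)])
  also have "\<dots> \<le> ep_mean \<alpha> \<theta> n (\<lambda>P. (f P - c)\<^sup>2 / \<epsilon>\<^sup>2)"
    unfolding ep_mean_def
  proof (intro sum_mono mult_right_mono nonneg)
    fix P
    have "\<epsilon>\<^sup>2 \<le> (f P - c)\<^sup>2" if "\<bar>f P - c\<bar> > \<epsilon>"
      using that assms(4) by (simp add: abs_le_square_iff[symmetric])
    then show "(if \<bar>f P - c\<bar> > \<epsilon> then 1 else 0) \<le> (f P - c)\<^sup>2 / \<epsilon>\<^sup>2"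
      using assms(4) by simp
  qed
  also have "(\<lambda>P. (f P - c)\<^sup>2 / \<epsilon>\<^sup>2) = (\<lambda>P. ((f P)\<^sup>2 - 2 * c * f P + c\<^sup>2) / \<epsilon>\<^sup>2)"
    by (simp add: power2_diff algebra_simps)
  also have "ep_mean \<alpha> \<theta> n \<dots> =
      (ep_mean \<alpha> \<theta> n (\<lambda>P. (f P)\<^sup>2) - 2 * c * ep_mean \<alpha> \<theta> n f + c\<^sup>2) / \<epsilon>\<^sup>2"
    unfolding ep_mean_divide ep_mean_add ep_mean_diff ep_mean_cmult ep_mean_const[OF assms(2,3)] ..
  finally show ?thesis .
qed

text \<open>With these two limits the mean squared distance to \<open>c\<close> tends to c^2 - 2 c c
  + c^2 = 0.\<close>

lemma tendsto_in_prob_ewens_pitman: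
  assumes ep: "\<And>n. n \<ge> 1 \<Longrightarrow> ewens_pitman_partition (M n) \<alpha> (\<theta> n) n (X n)"
    and \<theta>: "\<And>n. n \<ge> 1 \<Longrightarrow> \<theta> n > 0"
    and 1: "(\<lambda>n. ep_mean \<alpha> (\<theta> n) n (f n)) \<longlonglongrightarrow> c"
    and 2: "(\<lambda>n. ep_mean \<alpha> (\<theta> n) n (\<lambda>P. (f n P)\<^sup>2)) \<longlonglongrightarrow> c\<^sup>2"
  shows "tendsto_in_prob M (\<lambda>n \<omega>. f n (X n \<omega>)) c"
  unfolding tendsto_in_prob_def
proof (intro allI impI)
  fix \<epsilon> :: real assume \<epsilon>: "\<epsilon> > 0"
  have "(\<lambda>n. (ep_mean \<alpha> (\<theta> n) n (\<lambda>P. (f n P)\<^sup>2) - 2 * c * ep_mean \<alpha> (\<theta> n) n (f n) + c\<^sup>2) / \<epsilon>\<^sup>2)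
      \<longlonglongrightarrow> (c\<^sup>2 - 2 * c * c + c\<^sup>2) / \<epsilon>\<^sup>2"
    using \<epsilon> by (intro tendsto_intros 1 2) auto
  then have lim: "(\<lambda>n. (ep_mean \<alpha> (\<theta> n) n (\<lambda>P. (f n P)\<^sup>2)
      - 2 * c * ep_mean \<alpha> (\<theta> n) n (f n) + c\<^sup>2) / \<epsilon>\<^sup>2) \<longlonglongrightarrow> 0"
    by (simp add: power2_eq_square)
  show "(\<lambda>n. measure (M n) {\<omega> \<in> space (M n). \<epsilon> < \<bar>f n (X n \<omega>) - c\<bar>}) \<longlonglongrightarrow> 0"
  proof (rule tendsto_sandwich[OF _ _ tendsto_const lim])
    show "\<forall>\<^sub>F n in sequentially. measure (M n) {\<omega> \<in> space (M n). \<epsilon> < \<bar>f n (X n \<omega>) - c\<bar>} \<le>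
       (ep_mean \<alpha> (\<theta> n) n (\<lambda>P. (f n P)\<^sup>2) - 2 * c * ep_mean \<alpha> (\<theta> n) n (f n) + c\<^sup>2) / \<epsilon>\<^sup>2"
      using eventually_ge_at_top[of 1]
      by eventually_elim (rule ewens_pitman_Chebyshev; use ep \<theta> \<epsilon> in simp)
  qed simp
qed

section \<open>Operations on limits in probability\<close>

lemma tendsto_in_prob_cong:
  assumes "\<And>n \<omega>. n \<ge> N \<Longrightarrow> Y n \<omega> = Y' n \<omega>" "tendsto_in_prob M Y c"
  shows "tendsto_in_prob M Y' c"
  unfolding tendsto_in_prob_def
proof (intro allI impI)
  fix \<epsilon> :: real assume "\<epsilon> > 0"
  then have "(\<lambda>n. measure (M n) {\<omega> \<in> space (M n). \<bar>Y n \<omega> - c\<bar> > \<epsilon>}) \<longlonglongrightarrow> 0"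
    using assms(2) by (simp add: tendsto_in_prob_def)
  then show "(\<lambda>n. measure (M n) {\<omega> \<in> space (M n). \<bar>Y' n \<omega> - c\<bar> > \<epsilon>}) \<longlonglongrightarrow> 0"
    by (rule Lim_transform_eventually)
       (use assms(1) in \<open>auto simp: eventually_at_top_linorder intro!: exI[of _ N]\<close>)
qed

text \<open>Division is continuous at (c, d) because d is nonzero, so a quotient far from c / d
  forces one of the two variables away from its limit; the union bound adds the two
  probabilities.\<close>

lemma tendsto_in_prob_divide:
  assumes prob: "\<And>n. n \<ge> N \<Longrightarrow> prob_space (M n)"
    and Y: "\<And>n. n \<ge> N \<Longrightarrow> Y n \<in> borel_measurable (M n)"
    and Z: "\<And>n. n \<ge> N \<Longrightarrow> Z n \<in> borel_measurable (M n)"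
    and Yc: "tendsto_in_prob M Y c" and Zd: "tendsto_in_prob M Z d" and "d \<noteq> 0"
  shows "tendsto_in_prob M (\<lambda>n \<omega>. Y n \<omega> / Z n \<omega>) (c / d)"
  unfolding tendsto_in_prob_def
proof (intro allI impI)
  fix \<epsilon> :: real assume "\<epsilon> > 0"
  have "((\<lambda>p. fst p / snd p) \<longlongrightarrow> fst (c, d) / snd (c, d)) (nhds (c, d))"
    using \<open>d \<noteq> 0\<close> by (intro tendsto_divide tendsto_fst tendsto_snd filterlim_ident) auto
  then have "\<forall>\<^sub>F p in nhds (c, d). dist (fst p / snd p) (c / d) < \<epsilon>"
    using \<open>\<epsilon> > 0\<close> by (auto dest: tendstoD)
  then obtain e where e: "e > 0" "\<And>p. dist p (c, d) < e \<Longrightarrow> dist (fst p / snd p) (c / d) < \<epsilon>"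
    by (auto simp: eventually_nhds_metric)
  \<comment> \<open>Two deviations of at most \<delta> add up to at most 2e/3, strictly below
    e.\<close>
  define \<delta> where "\<delta> = e / 3"
  have \<delta>: "\<delta> > 0" using e by (simp add: \<delta>_def)
  have cont: "\<bar>y / z - c / d\<bar> < \<epsilon>" if "\<bar>y - c\<bar> \<le> \<delta>" "\<bar>z - d\<bar> \<le> \<delta>" for y z
  proof -
    have "dist (y, z) (c, d) \<le> \<bar>y - c\<bar> + \<bar>z - d\<bar>"
      unfolding dist_Pair_Pair dist_real_def
      by (rule order_trans[OF sqrt_sum_squares_le_sum_abs]) simp
    also have "\<dots> < e" using that e(1) by (simp add: \<delta>_def)
    finally show ?thesis using e(2)[of "(y, z)"] by (simp add: dist_real_def)
  qed
  have "(\<lambda>n. measure (M n) {\<omega> \<in> space (M n). \<bar>Y n \<omega> - c\<bar> > \<delta>}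
           + measure (M n) {\<omega> \<in> space (M n). \<bar>Z n \<omega> - d\<bar> > \<delta>}) \<longlonglongrightarrow> 0 + 0"
    using Yc Zd \<delta> unfolding tendsto_in_prob_def by (intro tendsto_add) auto
  then have lim: "(\<lambda>n. measure (M n) {\<omega> \<in> space (M n). \<bar>Y n \<omega> - c\<bar> > \<delta>}
           + measure (M n) {\<omega> \<in> space (M n). \<bar>Z n \<omega> - d\<bar> > \<delta>}) \<longlonglongrightarrow> 0"
    by simp
  show "(\<lambda>n. measure (M n) {\<omega> \<in> space (M n). \<epsilon> < \<bar>Y n \<omega> / Z n \<omega> - c / d\<bar>}) \<longlonglongrightarrow> 0"
  proof (rule tendsto_sandwich[OF _ _ tendsto_const lim])
    show "\<forall>\<^sub>F n in sequentially. measure (M n) {\<omega> \<in> space (M n). \<epsilon> < \<bar>Y n \<omega> / Z n \<omega> - c / d\<bar>} \<le>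
        measure (M n) {\<omega> \<in> space (M n). \<bar>Y n \<omega> - c\<bar> > \<delta>}
           + measure (M n) {\<omega> \<in> space (M n). \<bar>Z n \<omega> - d\<bar> > \<delta>}"
      using eventually_ge_at_top[of N]
    proof eventually_elim
      case (elim n)
      interpret prob_space "M n" using prob elim .
      note [measurable] = Y[OF elim] Z[OF elim]
      have "measure (M n) {\<omega> \<in> space (M n). \<epsilon> < \<bar>Y n \<omega> / Z n \<omega> - c / d\<bar>} \<le>
         measure (M n) ({\<omega> \<in> space (M n). \<bar>Y n \<omega> - c\<bar> > \<delta>} \<union> {\<omega> \<in> space (M n). \<bar>Z n \<omega> - d\<bar> > \<delta>})"
      proof (rule finite_measure_mono)
        show "{\<omega> \<in> space (M n). \<epsilon> < \<bar>Y n \<omega> / Z n \<omega> - c / d\<bar>} \<subseteq>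
          {\<omega> \<in> space (M n). \<bar>Y n \<omega> - c\<bar> > \<delta>} \<union> {\<omega> \<in> space (M n). \<bar>Z n \<omega> - d\<bar> > \<delta>}"
        proof
          fix \<omega> assume "\<omega> \<in> {\<omega> \<in> space (M n). \<epsilon> < \<bar>Y n \<omega> / Z n \<omega> - c / d\<bar>}"
          then show "\<omega> \<in> {\<omega> \<in> space (M n). \<bar>Y n \<omega> - c\<bar> > \<delta>} \<union>
              {\<omega> \<in> space (M n). \<bar>Z n \<omega> - d\<bar> > \<delta>}"
            using cont[of "Y n \<omega>" "Z n \<omega>"] by (auto simp: not_less[symmetric])
        qed
      qed measurable
      also have "\<dots> \<le> measure (M n) {\<omega> \<in> space (M n). \<bar>Y n \<omega> - c\<bar> > \<delta>}
           + measure (M n) {\<omega> \<in> space (M n). \<bar>Z n \<omega> - d\<bar> > \<delta>}"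
        by (rule measure_Un_le) measurable
      finally show ?case .
    qed
  qed simp
qed

text \<open>Rewrites the Gamma quotient as the rising factorial (1 - \<alpha>)_{r-1}, the form in
  which it arises from the block weights.\<close>

lemma sibuya_q_eq_pochhammer:
  assumes "0 < \<alpha>" "\<alpha> < 1" "r \<ge> 1"
  shows "sibuya_q \<alpha> r = \<alpha> * pochhammer (1 - \<alpha>) (r - 1) / fact r"
proof -
  have "1 - \<alpha> \<notin> \<int>\<^sub>\<le>\<^sub>0" using assms nonpos_Ints_nonpos[of "1 - \<alpha>"] by force
  then have "pochhammer (1 - \<alpha>) (r - 1) = Gamma (1 - \<alpha> + real (r - 1)) / Gamma (1 - \<alpha>)"
    by (rule pochhammer_Gamma)
  also have "1 - \<alpha> + real (r - 1) = real r - \<alpha>" using assms by simp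
  finally show ?thesis by (simp add: sibuya_q_def)
qed

section \<open>Limits of the rescaled moments\<close>

context
  fixes lam \<alpha> \<beta> :: real
  assumes lam: "lam > 0" and \<alpha>: "0 < \<alpha>" "\<alpha> < 1" and \<beta>: "0 < \<beta>" "\<beta> < 1"
begin

abbreviation (input) theta :: "nat \<Rightarrow> real" where
  "theta n \<equiv> lam * real n powr \<beta>"

abbreviation (input) scale :: "nat \<Rightarrow> real" where
  "scale n \<equiv> real n powr (\<alpha> + \<beta> * (1 - \<alpha>))"

text \<open>The order of growth of (\<theta> + \<alpha>)_m / (\<theta>)_m for m ~ n.\<close>

abbreviation (input) excess :: "nat \<Rightarrow> real" where
  "excess n \<equiv> real n powr (\<alpha> * (1 - \<beta>))"

text \<open>The exponent is \<beta> + \<alpha>(1 - \<beta>): the first summand is the order of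
  \<theta>, the second that of the ratio of rising factorials.\<close>

lemma scale_eq: "scale n = real n powr \<beta> * excess n"
  by (simp add: powr_add[symmetric] algebra_simps)

lemma theta_over: "(\<lambda>n. theta n / real n powr \<beta>) \<longlonglongrightarrow> lam"
proof (rule Lim_transform_eventually[OF tendsto_const])
  show "\<forall>\<^sub>F n in sequentially. lam = theta n / real n powr \<beta>"
    using eventually_ge_at_top[of 1] by eventually_elim simp
qed

lemma theta_over': "(\<lambda>n. (theta n + \<alpha>) / real n powr \<beta>) \<longlonglongrightarrow> lam"
proof -
  have "(\<lambda>n. \<alpha> / real n powr \<beta>) \<longlonglongrightarrow> 0" using \<beta> by real_asymp
  from tendsto_add[OF theta_over this] show ?thesis by (simp add: add_divide_distrib)
qed

lemma theta_over_n: "(\<lambda>n. theta n / real n) \<longlonglongrightarrow> 0"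
  using \<beta> by real_asymp

lemma diff_over_n: "(\<lambda>n. real (n - k) / real n) \<longlonglongrightarrow> 1"
proof -
  have "(\<lambda>n. (real n - real k) / real n) \<longlonglongrightarrow> 1" by real_asymp
  moreover have "\<forall>\<^sub>F n in sequentially. (real n - real k) / real n = real (n - k) / real n"
    using eventually_ge_at_top[of k] by eventually_elim (simp add: of_nat_diff)
  ultimately show ?thesis by (rule Lim_transform_eventually)
qed

lemma ratio_limit:
  "(\<lambda>n. pochhammer (theta n + \<alpha>) (n - k) / pochhammer (theta n) (n - k) / excess n)
     \<longlonglongrightarrow> lam powr (- \<alpha>)"
  by (rule pochhammer_ratio_tendsto[OF \<alpha> \<beta> lam theta_over diff_over_n])

lemma ratio_limit':
  "(\<lambda>n. pochhammer (theta n + \<alpha> + \<alpha>) (n - k) / pochhammer (theta n + \<alpha>) (n - k) / excess n)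
     \<longlonglongrightarrow> lam powr (- \<alpha>)"
  by (rule pochhammer_ratio_tendsto[OF \<alpha> \<beta> lam theta_over' diff_over_n])

lemma inverse_excess: "(\<lambda>n. 1 / excess n) \<longlonglongrightarrow> 0"
proof -
  have "\<alpha> * (1 - \<beta>) > 0" using \<alpha> \<beta> by simp
  then show ?thesis by real_asymp
qed

lemma inverse_scale: "(\<lambda>n. 1 / scale n) \<longlonglongrightarrow> 0"
proof -
  have "\<alpha> + \<beta> * (1 - \<alpha>) > 0" using \<alpha> \<beta> by (intro add_pos_pos) auto
  then show ?thesis by real_asymp
qed

lemma theta_pos: "n \<ge> 1 \<Longrightarrow> theta n > 0"
  using lam by simp

lemma lam_powr: "lam * lam powr (- \<alpha>) = lam powr (1 - \<alpha>)"
  using lam by (simp add: powr_diff powr_minus field_simps)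

lemma mean_num_blocks_limit:
  "(\<lambda>n. ep_mean \<alpha> (theta n) n (\<lambda>P. real (num_blocks P) / scale n)) \<longlonglongrightarrow> lam powr (1 - \<alpha>) / \<alpha>"
proof -
  define R where "R n = pochhammer (theta n + \<alpha>) n / pochhammer (theta n) n" for n :: nat
  \<comment> \<open>The exact mean \<theta>(R - 1)/\<alpha> divided by \<open>scale n\<close>; the
    subtracted 1 is negligible against \<open>excess n\<close>.\<close>
  have "(\<lambda>n. lam * (R n / excess n - 1 / excess n) / \<alpha>) \<longlonglongrightarrow> lam * (lam powr (- \<alpha>) - 0) / \<alpha>"
    unfolding R_def using \<alpha> ratio_limit[of 0]
    by (intro tendsto_divide tendsto_mult tendsto_diff tendsto_const inverse_excess) auto
  then have "(\<lambda>n. lam * (R n / excess n - 1 / excess n) / \<alpha>) \<longlonglongrightarrow> lam powr (1 - \<alpha>) / \<alpha>"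
    by (simp add: lam_powr)
  moreover have "\<forall>\<^sub>F n in sequentially. lam * (R n / excess n - 1 / excess n) / \<alpha> =
      ep_mean \<alpha> (theta n) n (\<lambda>P. real (num_blocks P) / scale n)"
    using eventually_ge_at_top[of 1]
  proof eventually_elim
    case (elim n)
    then have "real n powr \<beta> > 0" "excess n > 0" by auto
    then show ?case
      unfolding ep_mean_divide scale_eq ep_mean_num_blocks[OF theta_pos[OF elim] elim \<alpha>(1)]
        R_def[symmetric] using \<alpha> by (simp add: field_simps)
  qed
  ultimately show ?thesis by (rule Lim_transform_eventually)
qed

lemma mean_num_blocks_sq_limit:
  "(\<lambda>n. ep_mean \<alpha> (theta n) n (\<lambda>P. (real (num_blocks P) / scale n)\<^sup>2))
     \<longlonglongrightarrow> (lam powr (1 - \<alpha>) / \<alpha>)\<^sup>2"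
proof -
  define R where "R n = pochhammer (theta n + \<alpha>) n / pochhammer (theta n) n" for n :: nat
  define R' where "R' n = pochhammer (theta n + \<alpha> + \<alpha>) n / pochhammer (theta n + \<alpha>) n" for n :: nat
  define l where "l = lam powr (- \<alpha>)"
  \<comment> \<open>The exact second moment divided by the square of \<open>scale n\<close>, term by
    term; only the first term survives in the limit.\<close>
  let ?g = "\<lambda>n. (lam * ((theta n + \<alpha>) / real n powr \<beta>) * (R n / excess n) * (R' n / excess n)
     - \<alpha> * lam * (R n / excess n) * (1 / scale n)
     - 2 * lam\<^sup>2 * (R n / excess n) * (1 / excess n) + lam\<^sup>2 * (1 / excess n)\<^sup>2) / \<alpha>\<^sup>2"
  have "(\<lambda>n. R n / excess n) \<longlonglongrightarrow> l" "(\<lambda>n. R' n / excess n) \<longlonglongrightarrow> l"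
    unfolding R_def R'_def l_def using ratio_limit[of 0] ratio_limit'[of 0] by auto
  then have "?g \<longlonglongrightarrow> (lam * lam * l * l - \<alpha> * lam * l * 0 - 2 * lam\<^sup>2 * l * 0 + lam\<^sup>2 * 0\<^sup>2) / \<alpha>\<^sup>2"
    using \<alpha> by (intro tendsto_divide tendsto_add tendsto_diff tendsto_mult tendsto_power tendsto_const
        theta_over' inverse_excess inverse_scale) auto
  also have "lam * lam * l * l = (lam powr (1 - \<alpha>))\<^sup>2"
    unfolding l_def lam_powr[symmetric] by (simp add: power2_eq_square)
  finally have "?g \<longlonglongrightarrow> (lam powr (1 - \<alpha>) / \<alpha>)\<^sup>2"
    by (simp add: power_divide)
  moreover have "\<forall>\<^sub>F n in sequentially. ?g n =
      ep_mean \<alpha> (theta n) n (\<lambda>P. (real (num_blocks P) / scale n)\<^sup>2)"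
    using eventually_ge_at_top[of 1]
  proof eventually_elim
    case (elim n)
    then have "real n powr \<beta> > 0" "excess n > 0" by auto
    then show ?case
      unfolding power_divide ep_mean_divide scale_eq R_def[symmetric] R'_def[symmetric]
        ep_mean_num_blocks_sq[OF theta_pos[OF elim] elim \<alpha>(1)]
      using \<alpha> by (simp add: field_simps power2_eq_square)
  qed
  ultimately show ?thesis by (rule Lim_transform_eventually)
qed

lemma pochhammer_theta_limit:
  "(\<lambda>n. pochhammer (theta n + real (n - k)) r / real n ^ r) \<longlonglongrightarrow> 1"
  using tendsto_add[OF theta_over_n diff_over_n[of k]]
  by (intro pochhammer_over_power_tendsto) (simp add: add_divide_distrib)

context
  fixes r :: nat
  assumes r: "r \<ge> 1"
begin

text \<open>This is \<open>sibuya_q \<alpha> r\<close> times the limit of the rescaled number of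
  blocks.\<close>

abbreviation (input) "size_limit \<equiv> pochhammer (1 - \<alpha>) (r - 1) / fact r * lam powr (1 - \<alpha>)"

lemma choose_limit: "(\<lambda>n. real (n choose r) / real n ^ r) \<longlonglongrightarrow> 1 / fact r"
  using choose_over_power_tendsto[of 0 r] by simp

lemma mean_num_blocks_of_size_limit:
  "(\<lambda>n. ep_mean \<alpha> (theta n) n (\<lambda>P. real (num_blocks_of_size r P) / scale n)) \<longlonglongrightarrow> size_limit"
proof -
  define R where "R n = pochhammer (theta n + \<alpha>) (n - r) / pochhammer (theta n) (n - r)" for n :: nat
  define Q where "Q n = pochhammer (theta n + real (n - r)) r" for n :: nat
  define p where "p = pochhammer (1 - \<alpha>) (r - 1)"
  \<comment> \<open>The binomial coefficient and the tail \<open>Q n\<close> of the normaliser are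
    both of order n^r, so what remains is \<theta> times \<open>R n\<close>, of order
    \<open>scale n\<close>.\<close>
  let ?g = "\<lambda>n. (real (n choose r) / real n ^ r) * p * lam * (R n / excess n) / (Q n / real n ^ r)"
  have "?g \<longlonglongrightarrow> (1 / fact r) * p * lam * lam powr (- \<alpha>) / 1"
    unfolding R_def Q_def
    by (rule choose_limit ratio_limit pochhammer_theta_limit tendsto_const
        tendsto_mult tendsto_divide zero_neq_one[symmetric])+
  also have "(1 / fact r) * p * lam * lam powr (- \<alpha>) / 1 = size_limit"
    unfolding p_def lam_powr[symmetric] by simp
  finally have "?g \<longlonglongrightarrow> size_limit" .
  moreover have "\<forall>\<^sub>F n in sequentially. ?g n =
      ep_mean \<alpha> (theta n) n (\<lambda>P. real (num_blocks_of_size r P) / scale n)"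
    using eventually_ge_at_top[of 1] eventually_ge_at_top[of r]
  proof eventually_elim
    case (elim n)
    have "real n powr \<beta> > 0" "excess n > 0" "real n ^ r > 0" using elim by auto
    moreover have "Q n > 0"
      unfolding Q_def by (intro pochhammer_pos add_pos_nonneg theta_pos elim) simp
    ultimately show ?case
      unfolding ep_mean_divide scale_eq R_def[symmetric] Q_def[symmetric] p_def[symmetric]
        ep_mean_num_blocks_of_size[OF theta_pos[OF elim(1)] elim(1) r elim(2)]
      by (simp add: field_simps)
  qed
  ultimately show ?thesis by (rule Lim_transform_eventually)
qed

lemma mean_num_blocks_of_size_sq_limit:
  "(\<lambda>n. ep_mean \<alpha> (theta n) n (\<lambda>P. (real (num_blocks_of_size r P) / scale n)\<^sup>2))
     \<longlonglongrightarrow> size_limit\<^sup>2"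
proof -
  define R where
    "R n = pochhammer (theta n + \<alpha>) (n - 2 * r) / pochhammer (theta n) (n - 2 * r)" for n :: nat
  define R' where
    "R' n = pochhammer (theta n + \<alpha> + \<alpha>) (n - 2 * r) / pochhammer (theta n + \<alpha>) (n - 2 * r)"
    for n :: nat
  define Q where "Q n = pochhammer (theta n + real (n - 2 * r)) (2 * r)" for n :: nat
  define p where "p = pochhammer (1 - \<alpha>) (r - 1)"
  define l where "l = lam powr (- \<alpha>)"
  define F where "F n = ep_mean \<alpha> (theta n) n
    (\<lambda>P. real (num_blocks_of_size r P) * (real (num_blocks_of_size r P) - 1)) / (scale n)\<^sup>2"
    for n :: nat
  let ?g = "\<lambda>n. (real (n choose r) / real n ^ r) * (real ((n - r) choose r) / real n ^ r) * p\<^sup>2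
      * lam * ((theta n + \<alpha>) / real n powr \<beta>) * (R n / excess n) * (R' n / excess n)
      / (Q n / real n ^ (2 * r))"
  have "?g \<longlonglongrightarrow> (1 / fact r) * (1 / fact r) * p\<^sup>2 * lam * lam * l * l / 1"
    unfolding R_def R'_def Q_def l_def
    by (rule choose_limit choose_over_power_tendsto ratio_limit ratio_limit' theta_over'
        pochhammer_theta_limit tendsto_const tendsto_mult tendsto_divide zero_neq_one[symmetric])+
  also have "(1 / fact r) * (1 / fact r) * p\<^sup>2 * lam * lam * l * l / 1 = size_limit\<^sup>2"
    unfolding p_def l_def lam_powr[symmetric] by (simp add: power2_eq_square)
  finally have "?g \<longlonglongrightarrow> size_limit\<^sup>2" .
  moreover have "\<forall>\<^sub>F n in sequentially. ?g n = F n"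
    using eventually_ge_at_top[of 1] eventually_ge_at_top[of "2 * r"]
  proof eventually_elim
    case (elim n)
    have "real n powr \<beta> > 0" "excess n > 0" "real n ^ r > 0" using elim by auto
    moreover have "Q n > 0"
      unfolding Q_def by (intro pochhammer_pos add_pos_nonneg theta_pos elim) simp
    moreover have "real n ^ (2 * r) = real n ^ r * real n ^ r"
      by (simp add: mult_2 power_add)
    ultimately show ?case
      unfolding F_def scale_eq R_def[symmetric] R'_def[symmetric] Q_def[symmetric] p_def[symmetric]
        ep_mean_num_blocks_of_size_falling[OF theta_pos[OF elim(1)] elim(1) r elim(2) \<alpha>(1)]
      by (simp add: field_simps power2_eq_square)
  qed
  ultimately have F: "F \<longlonglongrightarrow> size_limit\<^sup>2" by (rule Lim_transform_eventually)
  \<comment> \<open>M^2 = M(M - 1) + M, and the last term contributes a convergent factor times 1 /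
    \<open>scale n\<close>, hence nothing in the limit.\<close>
  have "(\<lambda>n. F n + ep_mean \<alpha> (theta n) n (\<lambda>P. real (num_blocks_of_size r P) / scale n) * (1 / scale n))
      \<longlonglongrightarrow> size_limit\<^sup>2 + size_limit * 0"
    by (intro tendsto_add tendsto_mult F mean_num_blocks_of_size_limit inverse_scale)
  moreover have "ep_mean \<alpha> (theta n) n (\<lambda>P. (real (num_blocks_of_size r P) / scale n)\<^sup>2) =
     F n + ep_mean \<alpha> (theta n) n (\<lambda>P. real (num_blocks_of_size r P) / scale n) * (1 / scale n)" for n
  proof -
    have "(\<lambda>P. (real (num_blocks_of_size r P))\<^sup>2) = (\<lambda>P. real (num_blocks_of_size r P)
        * (real (num_blocks_of_size r P) - 1) + real (num_blocks_of_size r P))"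
      by (simp add: power2_eq_square algebra_simps)
    then have "ep_mean \<alpha> (theta n) n (\<lambda>P. (real (num_blocks_of_size r P))\<^sup>2) = ep_mean \<alpha> (theta n) n
        (\<lambda>P. real (num_blocks_of_size r P) * (real (num_blocks_of_size r P) - 1))
        + ep_mean \<alpha> (theta n) n (\<lambda>P. real (num_blocks_of_size r P))"
      by (simp only: ep_mean_add)
    then show ?thesis
      unfolding power_divide ep_mean_divide F_def
      by (simp add: add_divide_distrib power2_eq_square)
  qed
  ultimately show ?thesis by simp
qed

end

end

theorem theorem2:
  fixes lam \<alpha> \<beta> :: real
    and M :: "nat \<Rightarrow> 'a measure"
    and X :: "nat \<Rightarrow> 'a \<Rightarrow> nat set set"
  assumes "lam > 0"
    and "0 < \<alpha>" and "\<alpha> < 1"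
    and "0 < \<beta>" and "\<beta> < 1"
    and "\<And>n. n \<ge> 1 \<Longrightarrow> ewens_pitman_partition (M n) \<alpha> (lam * real n powr \<beta>) n (X n)"
  shows "tendsto_in_prob M
           (\<lambda>n \<omega>. real (num_blocks (X n \<omega>)) / real n powr (\<alpha> + \<beta> * (1 - \<alpha>)))
           (lam powr (1 - \<alpha>) / \<alpha>)
       \<and> (\<forall>r\<ge>1. tendsto_in_prob M
           (\<lambda>n \<omega>. real (num_blocks_of_size r (X n \<omega>)) / real (num_blocks (X n \<omega>)))
           (sibuya_q \<alpha> r))"
proof (intro conjI allI impI)
  note par = assms(1-5)
  show K: "tendsto_in_prob M
           (\<lambda>n \<omega>. real (num_blocks (X n \<omega>)) / real n powr (\<alpha> + \<beta> * (1 - \<alpha>)))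
           (lam powr (1 - \<alpha>) / \<alpha>)"
    by (rule tendsto_in_prob_ewens_pitman[OF assms(6) _
          mean_num_blocks_limit[OF par] mean_num_blocks_sq_limit[OF par]])
       (use par in auto)
  fix r :: nat assume r: "r \<ge> 1"
  let ?c = "pochhammer (1 - \<alpha>) (r - 1) / fact r * lam powr (1 - \<alpha>)"
  have N: "tendsto_in_prob M
           (\<lambda>n \<omega>. real (num_blocks_of_size r (X n \<omega>)) / real n powr (\<alpha> + \<beta> * (1 - \<alpha>))) ?c"
    by (rule tendsto_in_prob_ewens_pitman[OF assms(6) _
          mean_num_blocks_of_size_limit[OF par r] mean_num_blocks_of_size_sq_limit[OF par r]])
       (use par in auto)
  \<comment> \<open>The partitions carry the discrete sigma-algebra, so every real function of them
    is measurable.\<close>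
  have meas: "(\<lambda>\<omega>. f (X n \<omega>)) \<in> borel_measurable (M n)" if "n \<ge> 1" for f :: "_ \<Rightarrow> real" and n
    using assms(6)[OF that] unfolding ewens_pitman_partition_def
    by (auto intro: measurable_compose)
  have lim: "?c / (lam powr (1 - \<alpha>) / \<alpha>) = sibuya_q \<alpha> r"
    using par by (simp add: sibuya_q_eq_pochhammer[OF par(2,3) r])
  \<comment> \<open>Both counts concentrate at the same scale, and the limit of the denominator is
    positive.\<close>
  have "tendsto_in_prob M
     (\<lambda>n \<omega>. (real (num_blocks_of_size r (X n \<omega>)) / real n powr (\<alpha> + \<beta> * (1 - \<alpha>))) /
             (real (num_blocks (X n \<omega>)) / real n powr (\<alpha> + \<beta> * (1 - \<alpha>))))
     (?c / (lam powr (1 - \<alpha>) / \<alpha>))"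
    by (rule tendsto_in_prob_divide[OF _ meas meas N K, where N = 1])
       (use par assms(6) in \<open>auto simp: ewens_pitman_partition_def\<close>)
  \<comment> \<open>For n \<ge> 1 the common scale is positive and cancels; at n = 0 it is 0, hence
    the restriction to the tail.\<close>
  then show "tendsto_in_prob M
           (\<lambda>n \<omega>. real (num_blocks_of_size r (X n \<omega>)) / real (num_blocks (X n \<omega>)))
           (sibuya_q \<alpha> r)"
    unfolding lim by (rule tendsto_in_prob_cong[where N = 1, rotated]) simp
qed

end
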